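(* For every real $t$ with $0<t<1$, $$\frac{\pi}{2}-\frac12\ln\frac{(1+t)^{1-t}}{(1-t)^{1+t}}<E(t)<\frac{\pi-1}{2}+\frac{1-t^2}{4t}\ln\frac{1+t}{1-t},$$ where $E(t)=\int_0^{\pi/2}\sqrt{1-t^2\sin^2\theta}\,d\theta$.
   Context: For $0<t<1$, $E(t)=\int_0^{\pi/2}\sqrt{1-t^2\sin^2\theta}\,d\theta$ is a complete elliptic integral. $\ln$ denotes the natural logarithm. *)

theory Defs
  imports "HOL-Analysis.Analysis"
begin

text \<open>The complete elliptic integral of the second kind, as a function of the modulus
  \<open>t\<close> (not of the parameter \<open>t\<^sup>2\<close>).\<close>

definition elliptic_E :: "real \<Rightarrow> real" where
  "elliptic_E t = integral {0..pi/2} (\<lambda>\<theta>. sqrt (1 - t\<^sup>2 * (sin \<theta>)\<^sup>2))"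

end

theory Submission
  imports Defs
begin

text \<open>Write \<open>s = sin \<theta>\<close> and \<open>R = sqrt (1 - t\<^sup>2 s\<^sup>2)\<close>. The lower bound follows from the pointwise
  estimate \<open>R \<ge> 1 - t s\<close>, which gives \<open>E t \<ge> pi / 2 - t\<close>. The upper bound is exactly
  the integral of \<open>1 - s + s R\<close>, and this integrand exceeds \<open>R\<close> by \<open>(1 - s) (1 - R)\<close>.\<close>

text \<open>The difference of the two sides vanishes at \<open>0\<close> and has derivative
  \<open>y\<^sup>2 / (1 - y) \<ge> 0\<close>. The quadratic Taylor term is kept because it has to
  cancel a loss of size \<open>t\<^sup>2\<close> in the next lemma.\<close>

lemma add_half_square_le_minus_ln:
  fixes x :: real
  assumes "0 \<le> x" "x < 1"
  shows "x + x\<^sup>2 / 2 \<le> - ln (1 - x)"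
proof -
  define g where "g = (\<lambda>y::real. - ln (1 - y) - y - y\<^sup>2 / 2)"
  have "g 0 \<le> g x"
  proof (rule DERIV_nonneg_imp_nondecreasing[OF assms(1)])
    fix y :: real assume y: "0 \<le> y" "y \<le> x"
    have "(g has_real_derivative y\<^sup>2 / (1 - y)) (at y)"
      unfolding g_def using y assms
      by (auto intro!: derivative_eq_intros simp: field_simps power2_eq_square)
    moreover have "y\<^sup>2 / (1 - y) \<ge> 0"
      using y assms by simp
    ultimately show "\<exists>d. (g has_real_derivative d) (at y) \<and> 0 \<le> d" by blast
  qed
  then show ?thesis by (simp add: g_def)
qed

text \<open>Regrouped in terms of \<open>ln (1 - t)\<close> and \<open>ln (1 - t\<^sup>2)\<close>,
  the logarithm is a main term of at least \<open>2 * t + t\<^sup>2\<close> minus a correction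
  strictly below \<open>t\<^sup>2\<close>, hence exceeds \<open>2 * t\<close>. This passes from the
  bound \<open>pi/2 - t\<close> to the logarithmic one.\<close>

lemma less_half_ln_powr_quotient:
  fixes t :: real
  assumes "0 < t" "t < 1"
  shows "t < 1 / 2 * ln ((1 + t) powr (1 - t) / (1 - t) powr (1 + t))"
proof -
  have "ln ((1 + t) powr (1 - t) / (1 - t) powr (1 + t))
      = - 2 * ln (1 - t) - (1 - t) * (- ln (1 - t\<^sup>2))"
  proof -
    have "1 - t\<^sup>2 = (1 + t) * (1 - t)" by (simp add: algebra_simps power2_eq_square)
    then have "ln (1 - t\<^sup>2) = ln (1 + t) + ln (1 - t)"
      using assms by (simp add: ln_mult)
    then show ?thesis using assms by (simp add: ln_div ln_powr algebra_simps)
  qed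
  moreover have "t + t\<^sup>2 / 2 \<le> - ln (1 - t)"
    using assms by (intro add_half_square_le_minus_ln) auto
  \<comment> \<open>The inequality \<open>ln x \<le> x - 1\<close> at
    \<open>x = 1 / (1 - t\<^sup>2)\<close> bounds the correction by
    \<open>t\<^sup>2 / (1 + t)\<close>; strictness then comes from \<open>t > 0\<close>.\<close>
  moreover have "(1 - t) * (- ln (1 - t\<^sup>2)) < t\<^sup>2"
  proof -
    have t2: "t\<^sup>2 < 1" using assms by (simp add: power_less_one_iff)
    have "- ln (1 - t\<^sup>2) = ln (1 / (1 - t\<^sup>2))" using t2 by (simp add: ln_div)
    also have "\<dots> \<le> 1 / (1 - t\<^sup>2) - 1" using t2 by (intro ln_le_minus_one) simp
    finally have "(1 - t) * (- ln (1 - t\<^sup>2)) \<le> (1 - t) * (1 / (1 - t\<^sup>2) - 1)"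
      using assms by (intro mult_left_mono) auto
    also have "\<dots> = t\<^sup>2 / (1 + t)"
    proof -
      have "1 - t\<^sup>2 = (1 + t) * (1 - t)" by (simp add: algebra_simps power2_eq_square)
      moreover have "1 / (1 - t\<^sup>2) - 1 = t\<^sup>2 / (1 - t\<^sup>2)" using t2 by (simp add: field_simps)
      ultimately show ?thesis using assms by simp
    qed
    also have "\<dots> < t\<^sup>2" using assms by (simp add: field_simps)
    finally show ?thesis .
  qed
  ultimately show ?thesis by argo
qed

lemma one_minus_sq_sin_sq_pos:
  fixes t \<theta> :: real
  assumes "0 < t" "t < 1"
  shows "0 < 1 - t\<^sup>2 * (sin \<theta>)\<^sup>2"
proof -
  have "t\<^sup>2 * (sin \<theta>)\<^sup>2 \<le> t\<^sup>2 * 1" by (intro mult_left_mono) (auto simp: sin_squared_eq)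
  also have "\<dots> < 1" using assms by (simp add: power_less_one_iff)
  finally show ?thesis by simp
qed

lemma has_integral_sin_quarter: "(sin has_integral 1) {0..pi/2}"
proof -
  have "(sin has_integral (- cos (pi/2)) - (- cos 0)) {0..pi/2}"
    by (rule fundamental_theorem_of_calculus)
      (auto intro!: derivative_eq_intros simp: has_real_derivative_iff_has_vector_derivative[symmetric])
  then show ?thesis by simp
qed

lemma has_integral_elliptic_E:
  fixes t :: real
  shows "((\<lambda>\<theta>. sqrt (1 - t\<^sup>2 * (sin \<theta>)\<^sup>2)) has_integral elliptic_E t) {0..pi/2}"
  unfolding elliptic_E_def
  by (intro integrable_integral integrable_continuous_interval continuous_intros)

lemma has_integral_one_quarter: "((\<lambda>_. 1) has_integral pi/2) {0..pi/2 :: real}"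
  using has_integral_const_real[of "1::real" 0 "pi/2"] by simp

lemma elliptic_E_ge:
  assumes "0 < t" "t < 1"
  shows "pi/2 - t \<le> elliptic_E t"
proof -
  have "((\<lambda>\<theta>. 1 - t * sin \<theta>) has_integral pi/2 - t * 1) {0..pi/2}"
    by (intro has_integral_diff has_integral_one_quarter has_integral_mult_right has_integral_sin_quarter)
  then have "pi/2 - t * 1 \<le> elliptic_E t"
  proof (rule has_integral_le[OF _ has_integral_elliptic_E])
    fix \<theta> assume "\<theta> \<in> {0..pi/2}"
    then have s: "0 \<le> sin \<theta>" by (intro sin_ge_zero) auto
    have "t * sin \<theta> \<le> 1" using assms s by (intro mult_le_one) auto
    \<comment> \<open>With \<open>x = t * sin \<theta>\<close>, the claim
      \<open>(1 - x)\<^sup>2 \<le> 1 - x\<^sup>2\<close> amounts to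
      \<open>x\<^sup>2 \<le> x\<close>, which holds for \<open>x\<close> in
      \<open>[0, 1]\<close>.\<close>
    then have "(t * sin \<theta>) * (t * sin \<theta>) \<le> t * sin \<theta>"
      using mult_left_mono[of "t * sin \<theta>" 1 "t * sin \<theta>"] assms s by simp
    then show "1 - t * sin \<theta> \<le> sqrt (1 - t\<^sup>2 * (sin \<theta>)\<^sup>2)"
      by (intro real_le_rsqrt) (simp add: power2_eq_square algebra_simps)
  qed
  then show ?thesis by simp
qed

text \<open>The substitution \<open>c = cos \<theta>\<close> turns the integral into that of
  \<open>sqrt (1 - t\<^sup>2 + t\<^sup>2 * c\<^sup>2)\<close> over \<open>[0, 1]\<close>, which is
  elementary. \<open>F\<close> is the standard antiderivative in \<open>c\<close>, negated because
  \<open>dc = - sin \<theta> d\<theta>\<close>.\<close>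

lemma has_integral_sin_mult_sqrt:
  fixes t :: real
  assumes t: "0 < t" "t < 1"
  shows "((\<lambda>\<theta>. sin \<theta> * sqrt (1 - t\<^sup>2 * (sin \<theta>)\<^sup>2))
    has_integral 1/2 + (1 - t\<^sup>2) / (4 * t) * ln ((1 + t) / (1 - t))) {0..pi/2}"
proof -
  define R where "R = (\<lambda>\<theta>. sqrt (1 - t\<^sup>2 * (sin \<theta>)\<^sup>2))"
  define F where "F = (\<lambda>\<theta>. - (cos \<theta> * R \<theta> / 2 + (1 - t\<^sup>2) / (2 * t) * ln (t * cos \<theta> + R \<theta>)))"
  have deriv: "(F has_real_derivative sin \<theta> * R \<theta>) (at \<theta>)" if "\<theta> \<in> {0..pi/2}" for \<theta>
  proof -
    have pos: "0 < 1 - t\<^sup>2 * (sin \<theta>)\<^sup>2" using one_minus_sq_sin_sq_pos[OF t] .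
    have R0: "R \<theta> > 0" using pos by (simp add: R_def)
    have R2: "R \<theta> * R \<theta> = 1 - t\<^sup>2 * (sin \<theta>)\<^sup>2" using pos by (simp add: R_def)
    have c0: "cos \<theta> \<ge> 0" using that by (intro cos_ge_zero) auto
    have L0: "t * cos \<theta> + R \<theta> > 0" using c0 t R0 by (simp add: add_nonneg_pos)
    have DR: "(R has_real_derivative - (t\<^sup>2 * sin \<theta> * cos \<theta> / R \<theta>)) (at \<theta>)"
      unfolding R_def using pos
      by (auto intro!: derivative_eq_intros simp: field_simps)
    have DL: "((\<lambda>\<theta>. ln (t * cos \<theta> + R \<theta>)) has_real_derivative - (t * sin \<theta> / R \<theta>)) (at \<theta>)"
    proof -
      have "((\<lambda>\<theta>. ln (t * cos \<theta> + R \<theta>)) has_real_derivative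
          (- (t * sin \<theta>) - t\<^sup>2 * sin \<theta> * cos \<theta> / R \<theta>) / (t * cos \<theta> + R \<theta>)) (at \<theta>)"
        using L0 by (auto intro!: derivative_eq_intros DR)
      \<comment> \<open>The numerator contains the argument of the logarithm as a factor, so the
        quotient collapses.\<close>
      also have "- (t * sin \<theta>) - t\<^sup>2 * sin \<theta> * cos \<theta> / R \<theta>
          = - (t * sin \<theta> / R \<theta>) * (t * cos \<theta> + R \<theta>)"
        using R0 by (simp add: field_simps power2_eq_square)
      finally show ?thesis using L0 by simp
    qed
    have "(F has_real_derivative - ((- sin \<theta> * R \<theta> - cos \<theta> * (t\<^sup>2 * sin \<theta> * cos \<theta> / R \<theta>)) / 2
        - (1 - t\<^sup>2) / (2 * t) * (t * sin \<theta> / R \<theta>))) (at \<theta>)"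
      unfolding F_def
      by (rule DERIV_cong[OF DERIV_minus[OF DERIV_add[OF
            DERIV_cdivide[OF DERIV_mult[OF DERIV_cos DR]] DERIV_cmult[OF DL]]]]) algebra
    also have "- ((- sin \<theta> * R \<theta> - cos \<theta> * (t\<^sup>2 * sin \<theta> * cos \<theta> / R \<theta>)) / 2
        - (1 - t\<^sup>2) / (2 * t) * (t * sin \<theta> / R \<theta>))
      = sin \<theta> * (R \<theta> * R \<theta> + t\<^sup>2 * (cos \<theta>)\<^sup>2 + (1 - t\<^sup>2)) / (2 * R \<theta>)"
      using R0 t by (simp add: field_simps power2_eq_square)
    \<comment> \<open>By \<open>sin\<^sup>2 + cos\<^sup>2 = 1\<close>, the last two summands
      together are again \<open>1 - t\<^sup>2 * (sin \<theta>)\<^sup>2\<close>, the square of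
      \<open>R \<theta>\<close>.\<close>
    also have "R \<theta> * R \<theta> + t\<^sup>2 * (cos \<theta>)\<^sup>2 + (1 - t\<^sup>2) = 2 * (R \<theta> * R \<theta>)"
      unfolding R2 by (simp add: cos_squared_eq algebra_simps)
    also have "sin \<theta> * (2 * (R \<theta> * R \<theta>)) / (2 * R \<theta>) = sin \<theta> * R \<theta>"
      using R0 by simp
    finally show ?thesis .
  qed
  have "((\<lambda>\<theta>. sin \<theta> * R \<theta>) has_integral F (pi/2) - F 0) {0..pi/2}"
    by (rule fundamental_theorem_of_calculus)
      (auto intro!: has_field_derivative_at_within deriv
        simp: has_real_derivative_iff_has_vector_derivative[symmetric])
  moreover have "F (pi/2) - F 0 = 1/2 + (1 - t\<^sup>2) / (4 * t) * ln ((1 + t) / (1 - t))"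
  proof -
    have "1 - t\<^sup>2 = (1 + t) * (1 - t)" by (simp add: algebra_simps power2_eq_square)
    then have lnR: "ln (sqrt (1 - t\<^sup>2)) = (ln (1 + t) + ln (1 - t)) / 2"
      using t by (simp add: ln_sqrt ln_mult)
    \<comment> \<open>At \<open>pi/2\<close> the cosine vanishes and
      \<open>R = sqrt (1 - t\<^sup>2)\<close>; at \<open>0\<close> both \<open>cos\<close> and
      \<open>R\<close> equal \<open>1\<close>, which produces the \<open>1/2\<close> and
      \<open>ln (1 + t)\<close>.\<close>
    have "F (pi/2) - F 0 = 1/2 + (1 - t\<^sup>2) / (2 * t) * (ln (1 + t) - ln (sqrt (1 - t\<^sup>2)))"
      unfolding F_def R_def by (simp add: right_diff_distrib add.commute)
    also have "ln (1 + t) - ln (sqrt (1 - t\<^sup>2)) = ln ((1 + t) / (1 - t)) / 2"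
      unfolding lnR using t by (simp add: ln_div field_simps)
    finally show ?thesis by simp
  qed
  ultimately show ?thesis by (simp add: R_def)
qed

text \<open>\<open>G\<close> is the gap between the two integrands in factored form. Its integral is
  nonnegative since both factors are, and it cannot be zero because \<open>G\<close> is continuous
  and not identically zero.\<close>

lemma elliptic_E_less:
  fixes t :: real
  assumes t: "0 < t" "t < 1"
  shows "elliptic_E t < (pi - 1) / 2 + (1 - t\<^sup>2) / (4 * t) * ln ((1 + t) / (1 - t))"
proof -
  define R where "R = (\<lambda>\<theta>. sqrt (1 - t\<^sup>2 * (sin \<theta>)\<^sup>2))"
  define U where "U = 1/2 + (1 - t\<^sup>2) / (4 * t) * ln ((1 + t) / (1 - t))"
  define G where "G = (\<lambda>\<theta>. (1 - sin \<theta>) * (1 - R \<theta>))"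
  have "((\<lambda>\<theta>. (1 - sin \<theta> + sin \<theta> * R \<theta>) - R \<theta>) has_integral (pi/2 - 1 + U) - elliptic_E t) {0..pi/2}"
    unfolding R_def U_def
    by (intro has_integral_diff has_integral_add has_integral_one_quarter has_integral_sin_quarter
        has_integral_elliptic_E has_integral_sin_mult_sqrt t)
  then have int: "(G has_integral (pi/2 - 1 + U) - elliptic_E t) {0..pi/2}"
    by (simp add: G_def algebra_simps)
  have nonneg: "0 \<le> G \<theta>" for \<theta>
    unfolding G_def R_def by (intro mult_nonneg_nonneg) auto
  have cont: "continuous_on {0..pi/2} G"
    unfolding G_def R_def by (intro continuous_intros)
  have "pi/2 - 1 + U - elliptic_E t \<noteq> 0"
  proof
    assume "pi/2 - 1 + U - elliptic_E t = 0"
    then have "(G has_integral 0) (cbox 0 (pi/2))" using int by simp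
    \<comment> \<open>A continuous nonnegative function with integral \<open>0\<close> vanishes
      throughout. \<open>G\<close> does vanish at both endpoints, so an interior point is tested: at
      \<open>pi/6\<close> the sine is \<open>1/2\<close> and \<open>R < 1\<close>, so both factors
      are positive.\<close>
    then have "G (pi/6) = 0"
      using cont nonneg pi_gt_zero
      by (intro has_integral_0_cbox_imp_0[of 0 "pi/2" G]) (auto simp del: pi_gt_zero)
    then show False using t by (simp add: G_def R_def sin_30)
  qed
  moreover have "0 \<le> pi/2 - 1 + U - elliptic_E t"
    using int nonneg by (rule has_integral_nonneg)
  ultimately have "elliptic_E t < (pi - 1) / 2 + (U - 1/2)" by argo
  then show ?thesis by (simp add: U_def)
qed

theorem theorem1:
  fixes t :: real
  assumes "0 < t" and "t < 1"
  shows "pi / 2 - 1 / 2 * ln ((1 + t) powr (1 - t) / (1 - t) powr (1 + t)) < elliptic_E t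
    \<and> elliptic_E t < (pi - 1) / 2 + (1 - t\<^sup>2) / (4 * t) * ln ((1 + t) / (1 - t))"
  \<comment> \<open>Strictness on the left comes from the logarithmic estimate, since
    \<open>elliptic_E_ge\<close> is a weak inequality.\<close>
  using less_half_ln_powr_quotient[OF assms] elliptic_E_ge[OF assms] elliptic_E_less[OF assms]
  by linarith

end
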